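(* Let $(X,d)$ be a compact, connected metric space with more than one point and let $\mu$ be a finite positive Borel measure of full support on $X$. Suppose $\mu$ is doubling, i.e. there is $C>0$ with $0<\mu(B_{2r}(x))\le C\mu(B_r(x))$ for all $x\in X$ and $0<r<\mathrm{diam}(X)$, and that $(X,d,\mu)$ is variable time regular with exponent $\beta(\cdot)$, where $\beta$ is the local time exponent. Then $\beta(x)\ge 2$ for all $x\in X$.
   Context: $B_r(x)$ is the open ball and $B_r[x]=\{y:d(x,y)\le r\}$ the closed ball. Full support: $\mu(B_r(x))>0$ for all $x\in X,r>0$. Local time exponent. For $r>0$ let $v_r(x)=\mu(B_r(x))$, $a_r(x)=\frac1{\mu(B_r(x))}\int_{B_r(x)}\bigl(1+\frac{v_r(x)}{v_r(y)}\bigr)d\mu(y)$ and $w_r(x,y)=\frac{1}{a_r(x)\mu(B_r(x))}\chi_{B_r(x)}(y)\bigl(1+\frac{v_r(x)}{v_r(y)}\bigr)$. Let $(\mathbf y(r)_k)_{k\ge0}$ be the discrete time Markov chain on $X$ with transition density $w_r(x,\cdot)$ with respect to $\mu$. For a closed ball $B$ let $E_{r,B}(x)=\mathbb E^x[\inf\{k\ge 0:\mathbf y(r)_k\notin B\}]$ and $E^+_{r,B}=\sup_{y\in B}E_{r,B}(y)$. For $\gamma>0$ let $T_\gamma(B)=\limsup_{r\to0^+}E^+_{r,B}r^\gamma$, $\beta(B)=\sup\{\gamma>0:T_\gamma(B)=\infty\}\in[0,\infty]$ (with $\sup\emptyset=0$), and $\beta(x)=\inf_{R>0}\beta(B_R[x])$.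 It is assumed that $\beta$ is bounded above on $X$ (it is upper semicontinuous, hence Borel). Variable time regularity. For $r>0$ let $d_r(x)=\mu(B_r(x))r^{\beta(x)}$, $q_r(x)=\frac1{\mu(B_r(x))}\int_{B_r(x)}\bigl(1+\frac{d_r(x)}{d_r(y)}\bigr)d\mu(y)$, and $p_r(x,y)=\frac{1}{q_r(x)\mu(B_r(x))}\chi_{B_r(x)}(y)\bigl(1+\frac{d_r(x)}{d_r(y)}\bigr)$. Let $(\mathbf x(r)_t)_{t\ge0}$ be the continuous time pure jump Markov process on $X$ that waits at a site $x$ an exponentially distributed time of mean $r^{\beta(x)}$ and then jumps to a point chosen with density $p_r(x,\cdot)$ with respect to $\mu$. For a closed ball $B$ let $\phi_{r,B}(x)=\mathbb E^x[\inf\{t:\mathbf x(r)_t\notin B\}]$, $\phi^+_{r,B}=\sup_{y\in B}\phi_{r,B}(y)$ and $\mathcal T(B)=\limsup_{r\to0^+}\phi^+_{r,B}$. $(X,d,\mu)$ is variable time regular with exponent $\beta$ if there is $C>0$ such that $\frac1C r^{\beta(x)}\le\mathcal T(B_r[x])\le Cr^{\beta(x)}$ for all $x\in X$ and $0<r<\mathrm{diam}(X)/2$. *)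

theory Defs
  imports "HOL-Probability.Probability"
begin

section \<open>Metric measure spaces\<close>

text \<open>The metric space is the whole type; balls are the library balls of the type.\<close>

definition full_support :: "'a::metric_space measure \<Rightarrow> bool" where
  "full_support \<mu> \<longleftrightarrow> (\<forall>x r. 0 < r \<longrightarrow> 0 < measure \<mu> (ball x r))"

definition doubling :: "'a::metric_space measure \<Rightarrow> bool" where
  "doubling \<mu> \<longleftrightarrow> (\<exists>C>0. \<forall>x r. 0 < r \<and> r < diameter (UNIV :: 'a set) \<longrightarrow>
     0 < measure \<mu> (ball x (2 * r)) \<and> measure \<mu> (ball x (2 * r)) \<le> C * measure \<mu> (ball x r))"


section \<open>Markov chains\<close>

text \<open>
  The law, on the product space of all state sequences over \<^term>\<open>S\<close>, of the Markov chain started at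
  \<^term>\<open>x\<close> with transition kernel \<^term>\<open>K\<close>: the Ionescu-Tulcea projective limit.  It is meaningful
  when \<^term>\<open>K\<close> is a measurable family of probability measures on \<^term>\<open>S\<close>.
\<close>

definition markov_chain :: "'s measure \<Rightarrow> ('s \<Rightarrow> 's measure) \<Rightarrow> 's \<Rightarrow> (nat \<Rightarrow> 's) measure" where
  "markov_chain S K x =
     (let P = (\<lambda>n \<omega>. case n of 0 \<Rightarrow> return S x | Suc m \<Rightarrow> K (\<omega> m))
      in projective_family.lim UNIV (Ionescu_Tulcea.CI P (\<lambda>_. S)) (\<lambda>_. S))"

text \<open>
  Both random walks in use have a transition density (with respect to \<^term>\<open>\<mu>\<close>) of the same shape,
  with weight \<^term>\<open>s\<close> equal to the volume \<open>v\<^sub>r\<close> (giving \<open>a\<^sub>r\<close> and \<open>w\<^sub>r\<close>), or to \<open>d\<^sub>r\<close> (giving \<open>q\<^sub>r\<close> and \<open>p\<^sub>r\<close>).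
\<close>

definition walk_norm :: "'a::metric_space measure \<Rightarrow> ('a \<Rightarrow> real) \<Rightarrow> real \<Rightarrow> 'a \<Rightarrow> real" where
  "walk_norm \<mu> s r x = 1 / measure \<mu> (ball x r) * (LINT y:ball x r|\<mu>. 1 + s x / s y)"

definition walk_density :: "'a::metric_space measure \<Rightarrow> ('a \<Rightarrow> real) \<Rightarrow> real \<Rightarrow> 'a \<Rightarrow> 'a \<Rightarrow> real" where
  "walk_density \<mu> s r x y =
     1 / (walk_norm \<mu> s r x * measure \<mu> (ball x r)) * indicator (ball x r) y * (1 + s x / s y)"

definition walk :: "'a::metric_space measure \<Rightarrow> ('a \<Rightarrow> real) \<Rightarrow> real \<Rightarrow> 'a \<Rightarrow> (nat \<Rightarrow> 'a) measure" where
  "walk \<mu> s r = markov_chain borel (\<lambda>x. density \<mu> (\<lambda>y. ennreal (walk_density \<mu> s r x y)))"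


section \<open>The local time exponent\<close>

text \<open>Infima of exit times are taken in \<^typ>\<open>ennreal\<close>, so a path that never leaves has exit time \<open>\<infinity>\<close>.\<close>

definition exit_step :: "'a set \<Rightarrow> (nat \<Rightarrow> 'a) \<Rightarrow> ennreal" where
  "exit_step B Y = (INF k\<in>{k. Y k \<notin> B}. of_nat k)"

definition vol :: "'a::metric_space measure \<Rightarrow> real \<Rightarrow> 'a \<Rightarrow> real" where
  "vol \<mu> r x = measure \<mu> (ball x r)"

definition mean_exit_step :: "'a::metric_space measure \<Rightarrow> real \<Rightarrow> 'a set \<Rightarrow> 'a \<Rightarrow> ennreal" where
  "mean_exit_step \<mu> r B x = (\<integral>\<^sup>+ Y. exit_step B Y \<partial>walk \<mu> (vol \<mu> r) r x)"

definition max_mean_exit_step :: "'a::metric_space measure \<Rightarrow> real \<Rightarrow> 'a set \<Rightarrow> ennreal" where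
  "max_mean_exit_step \<mu> r B = (SUP y\<in>B. mean_exit_step \<mu> r B y)"

definition scaled_exit_limsup :: "'a::metric_space measure \<Rightarrow> real \<Rightarrow> 'a set \<Rightarrow> ennreal" where
  "scaled_exit_limsup \<mu> \<gamma> B =
     Limsup (at_right 0) (\<lambda>r. max_mean_exit_step \<mu> r B * ennreal (r powr \<gamma>))"

definition set_time_exponent :: "'a::metric_space measure \<Rightarrow> 'a set \<Rightarrow> ennreal" where
  "set_time_exponent \<mu> B = Sup {ennreal \<gamma> |\<gamma>. 0 < \<gamma> \<and> scaled_exit_limsup \<mu> \<gamma> B = \<infinity>}"

definition local_time_exponent :: "'a::metric_space measure \<Rightarrow> 'a \<Rightarrow> ennreal" where
  "local_time_exponent \<mu> x = (INF R\<in>{0<..}. set_time_exponent \<mu> (cball x R))"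


section \<open>Variable time regularity\<close>

definition weighted_vol :: "'a::metric_space measure \<Rightarrow> ('a \<Rightarrow> real) \<Rightarrow> real \<Rightarrow> 'a \<Rightarrow> real" where
  "weighted_vol \<mu> \<beta> r x = measure \<mu> (ball x r) * r powr \<beta> x"

text \<open>
  The continuous time process is realised on the product of the path space of its jump chain with a
  space of independent unit exponential clocks: the holding time at the \<open>n\<close>-th visited site \<^term>\<open>Y n\<close>
  is \<^term>\<open>m (Y n) * \<xi> n\<close>, which is exponential with mean \<^term>\<open>m (Y n)\<close>.  The number of the site
  occupied at time \<^term>\<open>t\<close> is the least \<open>n\<close> such that the first \<open>n + 1\<close> holding times add up to more
  than \<^term>\<open>t\<close>.  (If there is no such \<open>n\<close> the value is unspecified; this has probability zero
  when \<^term>\<open>m\<close> is bounded below by a positive constant.)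
\<close>

definition unit_clocks :: "(nat \<Rightarrow> real) measure" where
  "unit_clocks = (\<Pi>\<^sub>M n\<in>UNIV. density lborel (\<lambda>t. ennreal (exponential_density 1 t)))"

definition jump_process :: "('a \<Rightarrow> real) \<Rightarrow> (nat \<Rightarrow> 'a) \<Rightarrow> (nat \<Rightarrow> real) \<Rightarrow> real \<Rightarrow> 'a" where
  "jump_process m Y \<xi> t = Y (LEAST n. t < (\<Sum>i\<le>n. m (Y i) * \<xi> i))"

definition exit_time :: "'a set \<Rightarrow> (real \<Rightarrow> 'a) \<Rightarrow> ennreal" where
  "exit_time B X = (INF t\<in>{t. 0 \<le> t \<and> X t \<notin> B}. ennreal t)"

definition mean_exit_time ::
  "'a::metric_space measure \<Rightarrow> ('a \<Rightarrow> real) \<Rightarrow> real \<Rightarrow> 'a set \<Rightarrow> 'a \<Rightarrow> ennreal" where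
  "mean_exit_time \<mu> \<beta> r B x =
     (\<integral>\<^sup>+ (Y, \<xi>). exit_time B (jump_process (\<lambda>z. r powr \<beta> z) Y \<xi>)
        \<partial>(walk \<mu> (weighted_vol \<mu> \<beta> r) r x \<Otimes>\<^sub>M unit_clocks))"

definition max_mean_exit_time ::
  "'a::metric_space measure \<Rightarrow> ('a \<Rightarrow> real) \<Rightarrow> real \<Rightarrow> 'a set \<Rightarrow> ennreal" where
  "max_mean_exit_time \<mu> \<beta> r B = (SUP y\<in>B. mean_exit_time \<mu> \<beta> r B y)"

definition exit_time_limsup ::
  "'a::metric_space measure \<Rightarrow> ('a \<Rightarrow> real) \<Rightarrow> 'a set \<Rightarrow> ennreal" where
  "exit_time_limsup \<mu> \<beta> B = Limsup (at_right 0) (\<lambda>r. max_mean_exit_time \<mu> \<beta> r B)"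

definition variable_time_regular :: "'a::metric_space measure \<Rightarrow> ('a \<Rightarrow> real) \<Rightarrow> bool" where
  "variable_time_regular \<mu> \<beta> \<longleftrightarrow>
     (\<exists>C>0. \<forall>x r. 0 < r \<and> r < diameter (UNIV :: 'a set) / 2 \<longrightarrow>
        ennreal (1 / C * r powr \<beta> x) \<le> exit_time_limsup \<mu> \<beta> (cball x r) \<and>
        exit_time_limsup \<mu> \<beta> (cball x r) \<le> ennreal (C * r powr \<beta> x))"

end

theory Submission
  imports Defs "HOL-Real_Asymp.Real_Asymp"
begin

text \<open>
  The discrete walk is reversible: with \<open>J(x,y) = 1/v\<^sub>r(x) + 1/v\<^sub>r(y)\<close> for \<open>d(x,y) < r\<close> its density is
  \<open>J / a\<^sub>r\<close>.  Let \<open>u\<close> be the expected exit step from a ball \<open>B\<close> of radius \<open>R\<close>, and test its equation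
  \<open>u = 1 + P u\<close> against \<open>f\<^sup>2 / u\<close> for the tent function \<open>f\<close> on \<open>B\<close>.  Symmetry of \<open>J\<close> and AM-GM bound
  \<open>2 \<integral> f\<^sup>2 a\<^sub>r / u\<close> by the Dirichlet energy \<open>\<integral>\<integral> J(x,y) (f(x) - f(y))\<^sup>2\<close>, which is at most
  \<open>r\<^sup>2 \<integral>\<integral> J = 2 r\<^sup>2 \<mu>(X)\<close> because \<open>f\<close> is 1-Lipschitz and jumps are shorter than \<open>r\<close>.  As \<open>a\<^sub>r \<ge> 1\<close>,
  this forces \<open>sup u \<ge> c / r\<^sup>2\<close>, so every exponent \<open>\<gamma> < 2\<close> has an infinite scaled limit.
\<close>

section \<open>Exit times of Markov chains\<close>

locale markov_kernel =
  fixes S :: "'s measure" and K :: "'s \<Rightarrow> 's measure"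
  assumes K_prob: "K \<in> S \<rightarrow>\<^sub>M prob_algebra S"
begin

lemma K_subprob [measurable]: "K \<in> S \<rightarrow>\<^sub>M subprob_algebra S"
  using K_prob by (rule measurable_prob_algebraD)

lemma prob_space_K: "y \<in> space S \<Longrightarrow> prob_space (K y)"
  using measurable_space[OF K_prob] by (auto simp: space_prob_algebra)

lemma sets_K: "y \<in> space S \<Longrightarrow> sets (K y) = sets S"
  by (rule subprob_measurableD(2)[OF K_subprob])

text \<open>The one-step operator of the chain killed on leaving \<open>B\<close>. Membership is
  tested at the target point only, so the starting point may lie outside \<open>B\<close>.\<close>

definition killed :: "'s set \<Rightarrow> ('s \<Rightarrow> ennreal) \<Rightarrow> 's \<Rightarrow> ennreal" where
  "killed B h y = (\<integral>\<^sup>+ z. indicator B z * h z \<partial>K y)"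

lemma measurable_killed [measurable]:
  assumes [measurable]: "B \<in> sets S" "h \<in> borel_measurable S"
  shows "killed B h \<in> borel_measurable S"
  unfolding killed_def
  by (rule nn_integral_measurable_subprob_algebra2[OF _ K_subprob]) measurable

lemma measurable_killed_funpow:
  assumes "B \<in> sets S" "h \<in> borel_measurable S"
  shows "(killed B ^^ n) h \<in> borel_measurable S"
  by (induction n) (use assms in auto)

section \<open>Path probabilities from the Ionescu-Tulcea construction\<close>

context
  fixes x :: 's
  assumes x: "x \<in> space S"
begin

text \<open>The kernel family hidden in \<open>markov_chain\<close>, named so that the locale
  \<open>Ionescu_Tulcea\<close> can be instantiated. Coordinate 0 comes from the point mass at
  \<open>x\<close>, so coordinate \<open>Suc m\<close> is drawn from \<open>K\<close> at coordinate
  \<open>m\<close>.\<close>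

definition step :: "nat \<Rightarrow> (nat \<Rightarrow> 's) \<Rightarrow> 's measure" where
  "step n \<omega> = (case n of 0 \<Rightarrow> return S x | Suc m \<Rightarrow> K (\<omega> m))"

lemma Ionescu_Tulcea_step: "Ionescu_Tulcea step (\<lambda>_. S)"
proof (rule Ionescu_Tulcea.intro)
  show "step i \<in> (\<Pi>\<^sub>M j\<in>{0..<i}. S) \<rightarrow>\<^sub>M subprob_algebra S" for i
  proof (cases i)
    case 0
    then show ?thesis using x
      by (auto simp: step_def[abs_def] space_subprob_algebra subprob_space_return)
  next
    case (Suc m)
    then show ?thesis
      using measurable_compose[OF measurable_component_singleton[of m "{0..<i}" "\<lambda>_. S"] K_subprob]
      by (simp add: step_def[abs_def])
  qed
  show "prob_space (step i \<omega>)" if \<omega>: "\<omega> \<in> space (\<Pi>\<^sub>M j\<in>{0..<i}. S)" for i \<omega>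
  proof (cases i)
    case 0
    then show ?thesis using x by (simp add: step_def prob_space_return)
  next
    case (Suc m)
    then have "\<omega> m \<in> space S" using \<omega> by (auto simp: space_PiM)
    then show ?thesis using Suc by (simp add: step_def prob_space_K)
  qed
qed

interpretation IT: Ionescu_Tulcea step "\<lambda>_. S"
  by (rule Ionescu_Tulcea_step)

lemma markov_chain_eq: "markov_chain S K x = projective_family.lim UNIV IT.CI (\<lambda>_. S)"
  by (simp add: markov_chain_def step_def[abs_def])

text \<open>Integrating out the last coordinate turns the test function \<open>h\<close> into
  \<open>killed B h\<close>, hence the induction with \<open>h\<close> arbitrary.
  \<open>IT.C 0 (Suc n)\<close> carries coordinates 0 to \<open>n\<close>, that is, the start and
  \<open>n\<close> transitions; the start contributes the factor
  \<open>indicator B x\<close>.\<close>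

lemma nn_integral_C_path:
  assumes B [measurable]: "B \<in> sets S" and h: "h \<in> borel_measurable S"
  shows "(\<integral>\<^sup>+ \<omega>. (\<Prod>i\<le>n. indicator B (\<omega> i)) * h (\<omega> n) \<partial>IT.C 0 (Suc n) (\<lambda>_. undefined)) =
    indicator B x * (killed B ^^ n) h x"
  using h
proof (induction n arbitrary: h)
  case 0
  note [measurable] = 0
  have "IT.C 0 (Suc 0) (\<lambda>_. undefined) = IT.eP 0 (\<lambda>_. undefined)"
    using bind_return[OF IT.measurable_eP[of 0], of "\<lambda>_. undefined"] by simp
  then have "(\<integral>\<^sup>+ \<omega>. (\<Prod>i\<le>0. indicator B (\<omega> i)) * h (\<omega> 0) \<partial>IT.C 0 (Suc 0) (\<lambda>_. undefined))
    = (\<integral>\<^sup>+ \<omega>. indicator B (\<omega> 0) * h (\<omega> 0) \<partial>IT.eP 0 (\<lambda>_. undefined))"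
    by simp
  also have "\<dots> = (\<integral>\<^sup>+ z. indicator B z * h z \<partial>step 0 (\<lambda>_. undefined))"
    by (subst IT.nn_integral_eP) auto
  also have "\<dots> = indicator B x * h x"
    using x by (simp add: step_def nn_integral_return)
  finally show ?case by simp
next
  case (Suc n)
  note [measurable] = Suc.prems
  have *: "(\<integral>\<^sup>+ \<omega>'. (\<Prod>i\<le>Suc n. indicator B (\<omega>' i)) * h (\<omega>' (Suc n)) \<partial>IT.eP (Suc n) \<omega>)
    = (\<Prod>i\<le>n. indicator B (\<omega> i)) * killed B h (\<omega> n)"
    if \<omega>: "\<omega> \<in> space (\<Pi>\<^sub>M i\<in>{0..<Suc n}. S)" for \<omega>
  proof -
    have n: "\<omega> n \<in> space S" using \<omega> by (auto simp: space_PiM)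
    have m: "(\<lambda>z. indicator B z * h z) \<in> borel_measurable (K (\<omega> n))"
      unfolding measurable_cong_sets[OF sets_K[OF n] refl] by measurable
    have "(\<integral>\<^sup>+ \<omega>'. (\<Prod>i\<le>Suc n. indicator B (\<omega>' i)) * h (\<omega>' (Suc n)) \<partial>IT.eP (Suc n) \<omega>)
      = (\<integral>\<^sup>+ z. (\<Prod>i\<le>Suc n. indicator B (fun_upd \<omega> (Suc n) z i)) * h z \<partial>K (\<omega> n))"
      by (subst IT.nn_integral_eP[OF \<omega>]) (measurable, auto simp: step_def)
    also have "\<dots> = (\<integral>\<^sup>+ z. (\<Prod>i\<le>n. indicator B (\<omega> i)) * (indicator B z * h z) \<partial>K (\<omega> n))"
      by (intro nn_integral_cong) (simp add: mult_ac)
    also have "\<dots> = (\<Prod>i\<le>n. indicator B (\<omega> i)) * killed B h (\<omega> n)"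
      unfolding killed_def by (rule nn_integral_cmult[OF m])
    finally show ?thesis .
  qed
  have u: "(\<lambda>_. undefined) \<in> space (\<Pi>\<^sub>M i\<in>{0..<0::nat}. S)" by simp
  have "(\<integral>\<^sup>+ \<omega>. (\<Prod>i\<le>Suc n. indicator B (\<omega> i)) * h (\<omega> (Suc n)) \<partial>IT.C 0 (Suc (Suc n)) (\<lambda>_. undefined))
    = (\<integral>\<^sup>+ \<omega>. \<integral>\<^sup>+ \<omega>'. (\<Prod>i\<le>Suc n. indicator B (\<omega>' i)) * h (\<omega>' (Suc n)) \<partial>IT.eP (Suc n) \<omega>
        \<partial>IT.C 0 (Suc n) (\<lambda>_. undefined))"
    unfolding IT.C.simps(2)[of 0 "Suc n"] add_0
  proof (rule nn_integral_bind[where B="\<Pi>\<^sub>M i\<in>{0..<Suc (Suc n)}. S"])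
    show "(\<lambda>\<omega>. (\<Prod>i\<le>Suc n. indicator B (\<omega> i)) * h (\<omega> (Suc n)))
      \<in> borel_measurable (\<Pi>\<^sub>M i\<in>{0..<Suc (Suc n)}. S)"
      by measurable
    show "IT.eP (Suc n) \<in> IT.C 0 (Suc n) (\<lambda>_. undefined) \<rightarrow>\<^sub>M
        subprob_algebra (\<Pi>\<^sub>M i\<in>{0..<Suc (Suc n)}. S)"
      unfolding measurable_cong_sets[OF IT.sets_C[OF u] refl] add_0 by (rule IT.measurable_eP)
  qed
  also have "\<dots> = (\<integral>\<^sup>+ \<omega>. (\<Prod>i\<le>n. indicator B (\<omega> i)) * killed B h (\<omega> n) \<partial>IT.C 0 (Suc n) (\<lambda>_. undefined))"
    by (intro nn_integral_cong *) (simp only: IT.space_C[OF u], simp)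
  also have "\<dots> = indicator B x * (killed B ^^ n) (killed B h) x"
    by (rule Suc.IH) measurable
  finally show ?case by (simp add: funpow_swap1)
qed

lemma sets_markov_chain: "sets (markov_chain S K x) = sets (\<Pi>\<^sub>M i\<in>UNIV. S)"
  unfolding markov_chain_eq by (rule IT.PF.sets_lim)

text \<open>Survival up to time \<open>n\<close> is a cylinder event, so the projective limit gives
  it its finite-dimensional probability. Its indicator is the product in
  \<open>nn_integral_C_path\<close> with \<open>h\<close> constantly 1.\<close>

lemma emeasure_markov_chain_path:
  assumes B [measurable]: "B \<in> sets S"
  shows "emeasure (markov_chain S K x) {Y \<in> space (\<Pi>\<^sub>M i\<in>UNIV. S). \<forall>i\<le>n. Y i \<in> B} =
    indicator B x * (killed B ^^ n) (\<lambda>_. 1) x"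
proof -
  let ?J = "{0..<Suc n}"
  let ?X = "{Y \<in> space (\<Pi>\<^sub>M i\<in>?J. S). \<forall>i\<in>?J. Y i \<in> B}"
  have u: "(\<lambda>_. undefined) \<in> space (\<Pi>\<^sub>M i\<in>{0..<0::nat}. S)" by simp
  have X [measurable]: "?X \<in> sets (\<Pi>\<^sub>M i\<in>?J. S)" by measurable
  have emb: "{Y \<in> space (\<Pi>\<^sub>M i\<in>UNIV. S). \<forall>i\<le>n. Y i \<in> B} = prod_emb UNIV (\<lambda>_. S) ?J ?X"
    by (auto simp: prod_emb_def space_PiM PiE_iff less_Suc_eq_le)
  have "emeasure (markov_chain S K x) {Y \<in> space (\<Pi>\<^sub>M i\<in>UNIV. S). \<forall>i\<le>n. Y i \<in> B} = IT.CI ?J ?X"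
    unfolding markov_chain_eq emb by (rule IT.lim) (auto intro: X)
  also have "\<dots> = IT.C 0 (Suc n) (\<lambda>_. undefined) (prod_emb ?J (\<lambda>_. S) ?J ?X)"
    by (rule IT.emeasure_CI) (auto intro: X)
  also have "prod_emb ?J (\<lambda>_. S) ?J ?X = ?X"
    by (rule prod_emb_id) (auto simp: space_PiM)
  also have "IT.C 0 (Suc n) (\<lambda>_. undefined) ?X
    = (\<integral>\<^sup>+ \<omega>. indicator ?X \<omega> \<partial>IT.C 0 (Suc n) (\<lambda>_. undefined))"
    by (rule nn_integral_indicator[symmetric]) (simp only: IT.sets_C[OF u], simp)
  also have "\<dots> = (\<integral>\<^sup>+ \<omega>. (\<Prod>i\<le>n. indicator B (\<omega> i)) * 1 \<partial>IT.C 0 (Suc n) (\<lambda>_. undefined))"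
  proof (intro nn_integral_cong)
    fix \<omega> assume "\<omega> \<in> space (IT.C 0 (Suc n) (\<lambda>_. undefined))"
    then have \<omega>: "\<omega> \<in> space (\<Pi>\<^sub>M i\<in>?J. S)" by (simp only: IT.space_C[OF u], simp)
    show "indicator ?X \<omega> = (\<Prod>i\<le>n. indicator B (\<omega> i)) * (1::ennreal)"
    proof (cases "\<omega> \<in> ?X")
      case True
      then show ?thesis by (auto simp: less_Suc_eq_le intro!: prod.neutral[symmetric])
    next
      case False
      with \<omega> obtain i where "i \<le> n" "\<omega> i \<notin> B" by (auto simp: less_Suc_eq_le)
      then have "(\<Prod>i\<le>n. indicator B (\<omega> i)) = (0::ennreal)"
        by (intro prod_zero) (auto intro!: bexI[of _ i])
      with False show ?thesis by simp
    qed
  qed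
  also have "\<dots> = indicator B x * (killed B ^^ n) (\<lambda>_. 1) x"
    by (rule nn_integral_C_path) measurable
  finally show ?thesis .
qed

end

text \<open>One half of the tail-sum formula: if \<open>Y k\<close> lies outside \<open>B\<close>,
  the survival indicators vanish from index \<open>k\<close> on, which leaves at most
  \<open>k\<close> terms equal to 1. For a path that never leaves, the infimum is over the empty set
  and the bound is trivial.\<close>

lemma suminf_survival_le_exit_step:
  "(\<Sum>n. indicator {Y \<in> A. \<forall>i\<le>n. Y i \<in> B} Y) \<le> exit_step B Y"
  unfolding exit_step_def
proof (rule INF_greatest)
  fix k assume k: "k \<in> {k. Y k \<notin> B}"
  have "(\<Sum>n. indicator {Y \<in> A. \<forall>i\<le>n. Y i \<in> B} Y :: ennreal) = (\<Sum>n<k. indicator {Y \<in> A. \<forall>i\<le>n. Y i \<in> B} Y)"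
    using k by (intro suminf_finite) (auto simp: not_less split: split_indicator)
  also have "\<dots> \<le> (\<Sum>n<k. 1)"
    by (intro sum_mono) (auto split: split_indicator)
  finally show "(\<Sum>n. indicator {Y \<in> A. \<forall>i\<le>n. Y i \<in> B} Y) \<le> (of_nat k :: ennreal)" by simp
qed

text \<open>
  The start is counted even when it lies outside \<^term>\<open>B\<close>, so that the first-step equation below
  holds at every point.
\<close>

definition sojourn :: "'s set \<Rightarrow> 's \<Rightarrow> ennreal" where
  "sojourn B y = (\<Sum>n. (killed B ^^ n) (\<lambda>_. 1) y)"

lemma measurable_sojourn [measurable]: "B \<in> sets S \<Longrightarrow> sojourn B \<in> borel_measurable S"
  unfolding sojourn_def[abs_def] by (intro borel_measurable_suminf_order measurable_killed_funpow) auto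

text \<open>First-step analysis: one application of \<open>killed B\<close> shifts the defining
  series by one index, and the term of index 0 is 1.\<close>

lemma sojourn_eq:
  assumes B [measurable]: "B \<in> sets S" and y: "y \<in> space S"
  shows "sojourn B y = 1 + (\<integral>\<^sup>+ z. indicator B z * sojourn B z \<partial>K y)"
proof -
  have m: "(killed B ^^ n) (\<lambda>_. 1) \<in> borel_measurable (K y)" for n
    using measurable_killed_funpow[OF B, of "\<lambda>_. 1" n] by (simp add: measurable_cong_sets[OF sets_K[OF y] refl])
  have B': "indicator B \<in> borel_measurable (K y)"
    by (simp add: measurable_cong_sets[OF sets_K[OF y] refl])
  have "(\<integral>\<^sup>+ z. indicator B z * sojourn B z \<partial>K y)
    = (\<integral>\<^sup>+ z. (\<Sum>n. indicator B z * (killed B ^^ n) (\<lambda>_. 1) z) \<partial>K y)"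
    by (simp add: sojourn_def)
  also have "\<dots> = (\<Sum>n. \<integral>\<^sup>+ z. indicator B z * (killed B ^^ n) (\<lambda>_. 1) z \<partial>K y)"
    using m B' by (intro nn_integral_suminf borel_measurable_times_ennreal) auto
  also have "\<dots> = (\<Sum>n. (killed B ^^ Suc n) (\<lambda>_. 1) y)"
    by (simp add: killed_def)
  finally show ?thesis
    unfolding sojourn_def using suminf_offset[of "\<lambda>n. (killed B ^^ n) (\<lambda>_. 1) y" 1]
    by simp
qed

text \<open>For \<open>x\<close> in \<open>B\<close> the terms of \<open>sojourn\<close> are the
  survival probabilities, so the survival sum can be integrated term by term. Monotonicity of the
  nonnegative integral then gives the bound without measurability of
  \<open>exit_step\<close>.\<close>

lemma sojourn_le_mean_exit_step:
  assumes B [measurable]: "B \<in> sets S" and x: "x \<in> space S" "x \<in> B"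
  shows "sojourn B x \<le> (\<integral>\<^sup>+ Y. exit_step B Y \<partial>markov_chain S K x)"
proof -
  let ?A = "\<lambda>n. {Y \<in> space (\<Pi>\<^sub>M i\<in>UNIV. S). \<forall>i\<le>n. Y i \<in> B}"
  have A: "?A n \<in> sets (markov_chain S K x)" for n
    unfolding sets_markov_chain[OF x(1)] by measurable
  have "sojourn B x = (\<Sum>n. emeasure (markov_chain S K x) (?A n))"
    unfolding sojourn_def using x by (simp add: emeasure_markov_chain_path)
  also have "\<dots> = (\<Sum>n. \<integral>\<^sup>+ Y. indicator (?A n) Y \<partial>markov_chain S K x)"
    by (simp only: nn_integral_indicator[OF A])
  also have "\<dots> = (\<integral>\<^sup>+ Y. (\<Sum>n. indicator (?A n) Y) \<partial>markov_chain S K x)"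
    by (intro nn_integral_suminf[symmetric] borel_measurable_indicator A)
  also have "\<dots> \<le> (\<integral>\<^sup>+ Y. exit_step B Y \<partial>markov_chain S K x)"
    by (intro nn_integral_mono suminf_survival_le_exit_step)
  finally show ?thesis .
qed

end

section \<open>Dirichlet energy\<close>

text \<open>
  The last hypothesis says \<open>U = 1 + P U\<close> for the reversible kernel \<open>P = J / a\<close> killed outside \<^term>\<open>B\<close>,
  multiplied by \<open>a(x) = \<integral> J(x,y) dy\<close>.
\<close>

lemma (in finite_measure) ground_state_inequality:
  fixes J :: "'a \<Rightarrow> 'a \<Rightarrow> real" and U f :: "'a \<Rightarrow> real"
  assumes J_meas [measurable]: "(\<lambda>p. J (fst p) (snd p)) \<in> borel_measurable (M \<Otimes>\<^sub>M M)"
    and J: "\<And>x y. 0 \<le> J x y" "\<And>x y. J x y \<le> b" "\<And>x y. J x y = J y x"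
    and U_meas [measurable]: "U \<in> borel_measurable M"
    and U: "\<And>x. 1 \<le> U x" "\<And>x. U x \<le> L"
    and B [measurable]: "B \<in> sets M"
    and f_meas [measurable]: "f \<in> borel_measurable M"
    and f: "\<And>x. \<bar>f x\<bar> \<le> F" "\<And>x. x \<notin> B \<Longrightarrow> f x = 0"
    and lip: "\<And>x y. J x y \<noteq> 0 \<Longrightarrow> \<bar>f x - f y\<bar> \<le> r"
    and eq: "\<And>x. x \<in> space M \<Longrightarrow>
      (\<integral>y. J x y * (indicator B y * U y) \<partial>M) = (\<integral>y. J x y \<partial>M) * (U x - 1)"
  shows "2 * (\<integral>x. (f x)\<^sup>2 * (\<integral>y. J x y \<partial>M) / U x \<partial>M) \<le> r\<^sup>2 * (\<integral>x. \<integral>y. J x y \<partial>M \<partial>M)"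
proof -
  interpret P: pair_sigma_finite M M ..
  interpret PM: finite_measure "M \<Otimes>\<^sub>M M"
    by (rule finite_measure_pair_measure) unfold_locales
  have b: "0 \<le> b" using J(1,2) order_trans by blast
  have L: "1 \<le> L" using U order_trans by blast
  \<comment> \<open>With \<open>p = (x, y)\<close> this is
    \<open>J x y * (f x)\<^sup>2 / U x\<close> times \<open>U x - indicator B y * U y\<close>, the
    integrand of the equation tested against \<open>f\<^sup>2 / U\<close>. Integrating out
    \<open>y\<close> gives the left side of the claim; symmetrizing gives the energy bound.\<close>
  define \<Phi> where "\<Phi> p = J (fst p) (snd p) *
    ((f (fst p))\<^sup>2 * (1 - indicator B (snd p) * U (snd p) / U (fst p)))" for p
  have \<Phi>_meas [measurable]: "\<Phi> \<in> borel_measurable (M \<Otimes>\<^sub>M M)"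
    unfolding \<Phi>_def[abs_def] by measurable
  have \<Phi>_bound: "norm (\<Phi> p) \<le> b * (F\<^sup>2 * (1 + L))" for p
  proof -
    have "0 \<le> U (snd p) / U (fst p)" "U (snd p) / U (fst p) \<le> L"
      using U[of "fst p"] U[of "snd p"] L frac_le[of L "U (snd p)" 1 "U (fst p)"] by auto
    then have "\<bar>1 - indicator B (snd p) * U (snd p) / U (fst p)\<bar> \<le> 1 + L"
      using L by (auto split: split_indicator)
    moreover have "(f (fst p))\<^sup>2 \<le> F\<^sup>2"
      using f(1)[of "fst p"] abs_le_square_iff[of "f (fst p)" F] by linarith
    ultimately show ?thesis
      unfolding \<Phi>_def using J(1,2)[of "fst p" "snd p"] b L
      by (auto simp: abs_mult intro!: mult_mono)
  qed
  have \<Phi>_int: "integrable (M \<Otimes>\<^sub>M M) \<Phi>"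
    using \<Phi>_bound by (intro PM.integrable_const_bound[where B="b * (F\<^sup>2 * (1 + L))"]) auto
  have J_int: "integrable (M \<Otimes>\<^sub>M M) (\<lambda>p. J (fst p) (snd p))"
    using J by (intro PM.integrable_const_bound[where B=b]) auto
  have swap_int: "integrable (M \<Otimes>\<^sub>M M) (\<lambda>p. \<Phi> (snd p, fst p))"
    using P.integrable_product_swap[OF \<Phi>_int] by (simp add: case_prod_beta')
  have swap: "(\<integral>p. \<Phi> (snd p, fst p) \<partial>(M \<Otimes>\<^sub>M M)) = integral\<^sup>L (M \<Otimes>\<^sub>M M) \<Phi>"
    using P.integral_product_swap[OF \<Phi>_meas] by (simp add: case_prod_beta')
  have pointwise: "\<Phi> p + \<Phi> (snd p, fst p) \<le> r\<^sup>2 * J (fst p) (snd p)" for p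
  proof -
    obtain x y where p: "p = (x, y)" by (cases p)
    have sq: "(f x - f y)\<^sup>2 \<le> r\<^sup>2" if "J x y \<noteq> 0"
      using lip[OF that] abs_le_square_iff[of "f x - f y" r] by linarith
    have pos: "0 < U x" "0 < U y" using U(1)[of x] U(1)[of y] by auto
    have amgm: "2 * f x * f y \<le> (f x)\<^sup>2 * (U y / U x) + (f y)\<^sup>2 * (U x / U y)"
    proof -
      \<comment> \<open>The weight \<open>s\<close> makes the inequality a complete square in
        \<open>s * f x\<close> and \<open>f y / s\<close>.\<close>
      define s where "s = sqrt (U y / U x)"
      have s: "s > 0" "s\<^sup>2 = U y / U x" "(1 / s)\<^sup>2 = U x / U y"
        using pos by (auto simp: s_def power_divide)
      have "0 \<le> (f x * s - f y * (1 / s))\<^sup>2" by simp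
      also have "\<dots> = (f x)\<^sup>2 * s\<^sup>2 + (f y)\<^sup>2 * (1 / s)\<^sup>2 - 2 * f x * f y"
        using s(1) by (simp add: power2_diff power_mult_distrib power_divide)
      finally show ?thesis using s by simp
    qed
    \<comment> \<open>If both points lie in \<open>B\<close>, this is \<open>amgm\<close>. If one
      lies outside, \<open>f\<close> vanishes there and both sides agree.\<close>
    have "(f x)\<^sup>2 * (1 - indicator B y * U y / U x) + (f y)\<^sup>2 * (1 - indicator B x * U x / U y) \<le> (f x - f y)\<^sup>2"
      using amgm f(2)[of x] f(2)[of y]
      by (cases "x \<in> B"; cases "y \<in> B") (auto simp: algebra_simps power2_eq_square)
    \<comment> \<open>The Lipschitz bound is available only where \<open>J x y\<close> is nonzero,
      hence the case split.\<close>
    with sq have "J x y * ((f x)\<^sup>2 * (1 - indicator B y * U y / U x) + (f y)\<^sup>2 * (1 - indicator B x * U x / U y))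
        \<le> J x y * r\<^sup>2"
      using J(1)[of x y] by (cases "J x y = 0") (auto intro!: mult_left_mono)
    then show ?thesis
      unfolding p \<Phi>_def by (simp add: J(3)[of y x] algebra_simps)
  qed
  \<comment> \<open>With \<open>a\<close> the integral of \<open>J x\<close>, the hypothesis
    \<open>eq\<close> turns the killed term into \<open>a * (U x - 1)\<close>, and
    \<open>a - a * (U x - 1) / U x = a / U x\<close>.\<close>
  have inner: "(\<integral>y. \<Phi> (x, y) \<partial>M) = (f x)\<^sup>2 * (\<integral>y. J x y \<partial>M) / U x" if x: "x \<in> space M" for x
  proof -
    have J_x [measurable]: "J x \<in> borel_measurable M"
      using measurable_compose_Pair1[OF x J_meas] by simp
    have i1: "integrable M (J x)"
      using J by (intro integrable_const_bound[where B=b]) auto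
    have i2: "integrable M (\<lambda>y. J x y * (indicator B y * U y))"
    proof (rule integrable_const_bound[where B="b * L"])
      show "AE y in M. norm (J x y * (indicator B y * U y)) \<le> b * L"
      proof (rule AE_I2)
        fix y
        have "norm (indicator B y * U y) \<le> L"
          using U[of y] L by (auto split: split_indicator)
        then show "norm (J x y * (indicator B y * U y)) \<le> b * L"
          using J[of x y] b by (auto simp: abs_mult intro!: mult_mono)
      qed
    qed measurable
    have "(\<integral>y. \<Phi> (x, y) \<partial>M)
      = (\<integral>y. (f x)\<^sup>2 * J x y - (f x)\<^sup>2 / U x * (J x y * (indicator B y * U y)) \<partial>M)"
      by (intro Bochner_Integration.integral_cong) (auto simp: \<Phi>_def algebra_simps)
    also have "\<dots> = (f x)\<^sup>2 * (\<integral>y. J x y \<partial>M) - (f x)\<^sup>2 / U x * ((\<integral>y. J x y \<partial>M) * (U x - 1))"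
      using i1 i2 by (simp add: eq[OF x])
    also have "\<dots> = (f x)\<^sup>2 * (\<integral>y. J x y \<partial>M) / U x"
      using U(1)[of x] by (simp add: field_simps)
    finally show ?thesis .
  qed
  have "2 * (\<integral>x. (f x)\<^sup>2 * (\<integral>y. J x y \<partial>M) / U x \<partial>M) = 2 * (\<integral>x. \<integral>y. \<Phi> (x, y) \<partial>M \<partial>M)"
    using inner by (intro arg_cong[where f="(*) 2"] Bochner_Integration.integral_cong) auto
  \<comment> \<open>Swapping the variables preserves the integral, so the factor 2 becomes
    \<open>\<Phi>\<close> plus its reflection, to which \<open>pointwise\<close> applies.\<close>
  also have "\<dots> = integral\<^sup>L (M \<Otimes>\<^sub>M M) \<Phi> + (\<integral>p. \<Phi> (snd p, fst p) \<partial>(M \<Otimes>\<^sub>M M))"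
    unfolding swap P.integral_fst'[OF \<Phi>_int] by simp
  also have "\<dots> = (\<integral>p. \<Phi> p + \<Phi> (snd p, fst p) \<partial>(M \<Otimes>\<^sub>M M))"
    using \<Phi>_int swap_int by simp
  also have "\<dots> \<le> (\<integral>p. r\<^sup>2 * J (fst p) (snd p) \<partial>(M \<Otimes>\<^sub>M M))"
    using \<Phi>_int swap_int J_int pointwise by (intro integral_mono) auto
  also have "\<dots> = r\<^sup>2 * (\<integral>x. \<integral>y. J x y \<partial>M \<partial>M)"
    using P.integral_fst'[OF J_int] by simp
  finally show ?thesis .
qed

section \<open>The walk at scale \<open>r\<close>\<close>

lemma compact_UNIV_finite_net:
  assumes "compact (UNIV :: 'a::metric_space set)" and "0 < e"
  shows "\<exists>k::'a set. finite k \<and> (\<forall>x. \<exists>q\<in>k. dist q x < e)"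
proof -
  obtain k :: "'a set" where "finite k" "UNIV \<subseteq> (\<Union>q\<in>k. ball q e)"
    using seq_compact_imp_totally_bounded[OF compact_imp_seq_compact[OF assms(1)]] assms(2) by metis
  then show ?thesis by (intro exI[of _ k]) (auto simp: subset_eq)
qed

text \<open>The claim concerns the product of the Borel sigma-algebras, not the Borel sigma-algebra
  of the product. Compactness supplies a countable dense set, which writes
  \<open>dist x y < a\<close> as a countable union of the conditions
  \<open>dist x q + dist q y < a\<close>.\<close>

lemma borel_measurable_dist_compact:
  assumes "compact (UNIV :: 'a::metric_space set)"
  shows "(\<lambda>p. dist (fst p) (snd p)) \<in> borel_measurable (borel \<Otimes>\<^sub>M (borel :: 'a measure))"
proof -
  have "\<forall>n. \<exists>k::'a set. finite k \<and> (\<forall>x. \<exists>q\<in>k. dist q x < 1 / real (Suc n))"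
    using compact_UNIV_finite_net[OF assms] by simp
  then obtain k :: "nat \<Rightarrow> 'a set" where k: "\<And>n. finite (k n)"
    "\<And>n x. \<exists>q\<in>k n. dist q x < 1 / real (Suc n)"
    by metis
  have less_iff: "dist x y < a \<longleftrightarrow> (\<exists>q\<in>(\<Union>n. k n). dist x q + dist q y < a)" for x y :: 'a and a :: real
  proof
    assume "dist x y < a"
    \<comment> \<open>A detour through \<open>q\<close> lengthens the distance by at most
      \<open>2 * dist q x\<close>, hence half of the gap \<open>a - dist x y\<close>.\<close>
    then obtain n where n: "1 / real (Suc n) < (a - dist x y) / 2"
      using nat_approx_posE[of "(a - dist x y) / 2"] by auto
    obtain q where q: "q \<in> k n" "dist q x < 1 / real (Suc n)" using k(2)[of n x] by auto
    have "dist x q + dist q y < a"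
      using q(2) n dist_triangle[of q y x] by (simp add: dist_commute)
    then show "\<exists>q\<in>(\<Union>n. k n). dist x q + dist q y < a" using q(1) by auto
  next
    show "\<exists>q\<in>(\<Union>n. k n). dist x q + dist q y < a \<Longrightarrow> dist x y < a"
      using dist_triangle[of x y] order_le_less_trans by blast
  qed
  have [measurable]: "(\<lambda>x. dist x q) \<in> borel_measurable borel" "dist q \<in> borel_measurable borel" for q :: 'a
    by (auto intro!: borel_measurable_continuous_onI continuous_intros)
  have "countable (\<Union>n. k n)" using k(1) by (auto intro: countable_finite)
  then have "(\<Union>q\<in>(\<Union>n. k n). {p \<in> space (borel \<Otimes>\<^sub>M borel). dist (fst p) q + dist q (snd p) < a})
      \<in> sets (borel \<Otimes>\<^sub>M (borel :: 'a measure))" for a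
    by (rule sets.countable_UN'') measurable
  moreover have "(\<Union>q\<in>(\<Union>n. k n). {p \<in> space (borel \<Otimes>\<^sub>M borel). dist (fst p) q + dist q (snd p) < a})
      = {p \<in> space (borel \<Otimes>\<^sub>M (borel :: 'a measure)). dist (fst p) (snd p) < a}" for a
    unfolding less_iff by auto
  ultimately show ?thesis
    unfolding borel_measurable_iff_less by simp
qed

locale compact_metric_measure = finite_measure \<mu>
  for \<mu> :: "'a::metric_space measure" +
  assumes compact_UNIV: "compact (UNIV :: 'a set)"
    and sets_borel [measurable_cong]: "sets \<mu> = sets borel"
    and supp: "full_support \<mu>"
begin

lemma space_UNIV [simp]: "space \<mu> = UNIV"
  using sets_eq_imp_space_eq[OF sets_borel] by simp

lemma measurable_dist [measurable]:
  "(\<lambda>p. dist (fst p) (snd p)) \<in> borel_measurable (\<mu> \<Otimes>\<^sub>M \<mu>)"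
  using borel_measurable_dist_compact[OF compact_UNIV]
  by (simp add: measurable_cong_sets[OF sets_pair_measure_cong[OF sets_borel sets_borel] refl])

lemma measurable_ball [measurable]: "ball x r \<in> sets \<mu>"
  by (simp add: sets_borel)

section \<open>Volumes of balls at a fixed radius\<close>

lemma vol_pos: "0 < r \<Longrightarrow> 0 < vol \<mu> r x"
  using supp by (simp add: vol_def full_support_def)

text \<open>Every ball of radius \<open>r\<close> contains the ball of radius \<open>r / 2\<close>
  about some point of a finite net, and these finitely many balls have a positive minimal volume by
  full support.\<close>

lemma vol_bounded_below:
  assumes r: "0 < r"
  shows "\<exists>\<delta>>0. \<forall>x. \<delta> \<le> vol \<mu> r x"
proof -
  obtain k :: "'a set" where k: "finite k" "\<And>x. \<exists>q\<in>k. dist q x < r / 2"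
    using compact_UNIV_finite_net[OF compact_UNIV, of "r / 2"] r by auto
  then have "k \<noteq> {}" by auto
  define \<delta> where "\<delta> = Min (vol \<mu> (r / 2) ` k)"
  have "0 < \<delta>"
    using k(1) \<open>k \<noteq> {}\<close> r by (auto simp: \<delta>_def intro!: vol_pos)
  moreover have "\<delta> \<le> vol \<mu> r x" for x
  proof -
    obtain c where c: "c \<in> k" "dist c x < r / 2" using k(2)[of x] by auto
    have "\<delta> \<le> vol \<mu> (r / 2) c" using k(1) c(1) by (simp add: \<delta>_def)
    also have "ball c (r / 2) \<subseteq> ball x r"
    proof
      fix z assume "z \<in> ball c (r / 2)"
      then show "z \<in> ball x r" using c(2) dist_triangle[of x z c] by (simp add: dist_commute)
    qed
    then have "vol \<mu> (r / 2) c \<le> vol \<mu> r x"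
      unfolding vol_def by (intro finite_measure_mono) auto
    finally show ?thesis .
  qed
  ultimately show ?thesis by blast
qed

lemma inverse_vol_bounded:
  assumes r: "0 < r"
  shows "\<exists>c>0. \<forall>x. 1 / vol \<mu> r x \<le> c"
proof -
  obtain \<delta> where \<delta>: "0 < \<delta>" "\<And>x. \<delta> \<le> vol \<mu> r x"
    using vol_bounded_below[OF r] by blast
  then have "1 / vol \<mu> r x \<le> 1 / \<delta>" for x
    using vol_pos[OF r, of x] by (intro divide_left_mono) auto
  with \<delta>(1) show ?thesis by (intro exI[of _ "1 / \<delta>"]) auto
qed

text \<open>Balls are the sections of the measurable set of pairs at distance less than
  \<open>r\<close>.\<close>

lemma measurable_vol [measurable]: "vol \<mu> r \<in> borel_measurable \<mu>"
proof -
  have "{p \<in> space (\<mu> \<Otimes>\<^sub>M \<mu>). dist (fst p) (snd p) < r} \<in> sets (\<mu> \<Otimes>\<^sub>M \<mu>)" by measurable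
  then have "(\<lambda>x. emeasure \<mu> (Pair x -` {p \<in> space (\<mu> \<Otimes>\<^sub>M \<mu>). dist (fst p) (snd p) < r})) \<in> borel_measurable \<mu>"
    by (rule measurable_emeasure_Pair)
  moreover have "Pair x -` {p \<in> space (\<mu> \<Otimes>\<^sub>M \<mu>). dist (fst p) (snd p) < r} = ball x r" for x
    by (auto simp: space_pair_measure)
  ultimately have "(\<lambda>x. emeasure \<mu> (ball x r)) \<in> borel_measurable \<mu>" by (simp only:)
  then show ?thesis unfolding vol_def[abs_def] measure_def by measurable
qed

text \<open>The symmetric \<open>J\<close> of the overview: dividing
  \<open>1 + vol \<mu> r x / vol \<mu> r y\<close> by \<open>vol \<mu> r x\<close> makes the
  unnormalized walk density symmetric. Its integral \<open>total_conductance\<close> turns out to be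
  the normalization \<open>a\<^sub>r\<close>.\<close>

definition conductance :: "real \<Rightarrow> 'a \<Rightarrow> 'a \<Rightarrow> real" where
  "conductance r x y = indicator (ball x r) y * (1 / vol \<mu> r x + 1 / vol \<mu> r y)"

definition total_conductance :: "real \<Rightarrow> 'a \<Rightarrow> real" where
  "total_conductance r x = (\<integral>y. conductance r x y \<partial>\<mu>)"

lemma indicator_ball: "indicator (ball x r) y = (if dist x y < r then 1 else 0)"
  by (auto split: split_indicator)

lemma measurable_conductance [measurable]:
  "(\<lambda>p. conductance r (fst p) (snd p)) \<in> borel_measurable (\<mu> \<Otimes>\<^sub>M \<mu>)"
  unfolding conductance_def indicator_ball by measurable

lemma measurable_conductance2 [measurable]: "conductance r x \<in> borel_measurable \<mu>"
  using measurable_compose_Pair1[OF _ measurable_conductance, of x] by simp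

lemma conductance_sym: "conductance r x y = conductance r y x"
  by (auto simp: conductance_def dist_commute split: split_indicator)

lemma conductance_nonneg: "0 \<le> conductance r x y"
  by (auto simp: conductance_def vol_def split: split_indicator)

lemma conductance_bounded:
  assumes "0 < r"
  shows "\<exists>b. \<forall>x y. conductance r x y \<le> b"
proof -
  obtain c where c: "0 < c" "\<And>x. 1 / vol \<mu> r x \<le> c"
    using inverse_vol_bounded[OF assms] by blast
  have "conductance r x y \<le> c + c" for x y
    using c(1) add_mono[OF c(2)[of x] c(2)[of y]]
    by (auto simp: conductance_def split: split_indicator)
  then show ?thesis by blast
qed

lemma integrable_conductance:
  assumes "0 < r"
  shows "integrable \<mu> (conductance r x)"
proof -
  obtain b where "\<And>x y. conductance r x y \<le> b"
    using conductance_bounded[OF assms] by blast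
  then show ?thesis
    by (intro integrable_const_bound[where B=b]) (auto simp: conductance_nonneg)
qed

lemma measurable_total_conductance [measurable]: "total_conductance r \<in> borel_measurable \<mu>"
  unfolding total_conductance_def[abs_def]
  by (rule borel_measurable_lebesgue_integral) (simp add: case_prod_beta')

lemma integral_ball_vol:
  assumes "0 < r"
  shows "(\<integral>y. indicator (ball x r) y * (1 / vol \<mu> r x) \<partial>\<mu>) = 1"
proof -
  have "(\<integral>y. indicator (ball x r) y * (1 / vol \<mu> r x) \<partial>\<mu>) = vol \<mu> r x * (1 / vol \<mu> r x)"
    by (subst Bochner_Integration.integral_mult_left_zero) (simp add: vol_def)
  then show ?thesis using vol_pos[OF assms, of x] by simp
qed

text \<open>The summand \<open>1 / vol \<mu> r x\<close> alone is the uniform probability density on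
  the ball.\<close>

lemma total_conductance_ge_1:
  assumes r: "0 < r"
  shows "1 \<le> total_conductance r x"
proof -
  have "1 = (\<integral>y. indicator (ball x r) y * (1 / vol \<mu> r x) \<partial>\<mu>)"
    by (rule integral_ball_vol[OF r, symmetric])
  also have "\<dots> \<le> total_conductance r x"
    unfolding total_conductance_def
  proof (rule integral_mono[OF _ integrable_conductance[OF r]])
    show "integrable \<mu> (\<lambda>y. indicator (ball x r) y * (1 / vol \<mu> r x))"
      by (intro integrable_mult_left integrable_real_indicator) (auto simp: less_top[symmetric])
  qed (auto simp: conductance_def vol_def split: split_indicator)
  finally show ?thesis .
qed

lemma total_conductance_bounded:
  assumes r: "0 < r"
  shows "\<exists>b. \<forall>x. total_conductance r x \<le> b"
proof -
  obtain b where b: "\<And>x y. conductance r x y \<le> b" using conductance_bounded[OF r] by blast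
  have "total_conductance r x \<le> (\<integral>y. b \<partial>\<mu>)" for x
    unfolding total_conductance_def by (intro integral_mono integrable_conductance r b) auto
  then show ?thesis by blast
qed

text \<open>The conductance is \<open>g x y + g y x\<close>, where \<open>g x\<close> is the uniform
  density on the ball about \<open>x\<close>. By Fubini both halves contribute the total mass. As
  the value is independent of \<open>r\<close>, the energy bound is of order
  \<open>r\<^sup>2\<close>.\<close>

lemma integral_total_conductance:
  assumes r: "0 < r"
  shows "(\<integral>x. total_conductance r x \<partial>\<mu>) = 2 * measure \<mu> UNIV"
proof -
  interpret P: pair_sigma_finite \<mu> \<mu> ..
  interpret PM: finite_measure "\<mu> \<Otimes>\<^sub>M \<mu>"
    by (rule finite_measure_pair_measure) unfold_locales
  obtain c where c: "0 < c" "\<And>x. 1 / vol \<mu> r x \<le> c"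
    using inverse_vol_bounded[OF r] by blast
  define g where "g x y = indicator (ball x r) y * (1 / vol \<mu> r x)" for x y
  have [measurable]: "(\<lambda>p. g (fst p) (snd p)) \<in> borel_measurable (\<mu> \<Otimes>\<^sub>M \<mu>)"
    unfolding g_def indicator_ball by measurable
  have g_bound: "norm (g x y) \<le> c" for x y
    using c(2)[of x] c(1) vol_pos[OF r, of x] by (auto simp: g_def split: split_indicator)
  have g_int: "integrable (\<mu> \<Otimes>\<^sub>M \<mu>) (\<lambda>(x, y). g x y)"
    using g_bound by (intro PM.integrable_const_bound[where B="c"]) (auto simp: case_prod_beta')
  have g1: "integrable \<mu> (g x)" for x
    using g_bound measurable_compose_Pair1[of x \<mu> "\<lambda>p. g (fst p) (snd p)" \<mu> borel]
    by (intro integrable_const_bound[where B="c"]) auto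
  have g2: "integrable \<mu> (\<lambda>y. g y x)" for x
    using g_bound measurable_compose[OF measurable_Pair2'[of x \<mu> \<mu>], of "\<lambda>p. g (fst p) (snd p)" borel]
    by (intro integrable_const_bound[where B="c"]) auto
  have "conductance r x y = g x y + g y x" for x y
    by (auto simp: conductance_def g_def dist_commute split: split_indicator)
  then have "total_conductance r x = (\<integral>y. g x y \<partial>\<mu>) + (\<integral>y. g y x \<partial>\<mu>)" for x
    using g1 g2 by (simp add: total_conductance_def)
  moreover have "(\<integral>y. g x y \<partial>\<mu>) = 1" for x
    unfolding g_def by (rule integral_ball_vol[OF r])
  moreover have "(\<integral>x. \<integral>y. g y x \<partial>\<mu> \<partial>\<mu>) = (\<integral>x. \<integral>y. g x y \<partial>\<mu> \<partial>\<mu>)"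
    by (rule P.Fubini_integral[OF g_int])
  moreover have "integrable \<mu> (\<lambda>x. \<integral>y. g y x \<partial>\<mu>)"
    by (rule P.integrable_snd[OF g_int])
  ultimately show ?thesis by simp
qed

lemma walk_norm_eq:
  assumes r: "0 < r"
  shows "walk_norm \<mu> (vol \<mu> r) r x = total_conductance r x"
proof -
  have "walk_norm \<mu> (vol \<mu> r) r x =
      (\<integral>y. 1 / vol \<mu> r x * (indicator (ball x r) y *\<^sub>R (1 + vol \<mu> r x / vol \<mu> r y)) \<partial>\<mu>)"
    unfolding walk_norm_def set_lebesgue_integral_def by (simp add: vol_def)
  also have "\<dots> = total_conductance r x"
    unfolding total_conductance_def conductance_def using vol_pos[OF r, of x]
    by (intro Bochner_Integration.integral_cong) (auto simp: field_simps)
  finally show ?thesis .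
qed

text \<open>Cancelling the volume of the ball exhibits the walk as reversible, with symmetric
  conductances and reversing weight \<open>total_conductance\<close>.\<close>

lemma walk_density_eq:
  assumes r: "0 < r"
  shows "walk_density \<mu> (vol \<mu> r) r x y = conductance r x y / total_conductance r x"
  unfolding walk_density_def walk_norm_eq[OF r] conductance_def
  using vol_pos[OF r, of x] by (auto simp: vol_def field_simps)

section \<open>Normalization and measurability of the transition kernel\<close>

definition kernel :: "real \<Rightarrow> 'a \<Rightarrow> 'a measure" where
  "kernel r x = density \<mu> (\<lambda>y. ennreal (walk_density \<mu> (vol \<mu> r) r x y))"

lemma nn_integral_kernel:
  assumes r: "0 < r" and g [measurable]: "g \<in> borel_measurable \<mu>"
  shows "(\<integral>\<^sup>+ y. g y \<partial>kernel r x) = (\<integral>\<^sup>+ y. ennreal (conductance r x y / total_conductance r x) * g y \<partial>\<mu>)"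
  unfolding kernel_def walk_density_eq[OF r] by (rule nn_integral_density) measurable

lemma sets_kernel: "sets (kernel r x) = sets borel"
  by (simp add: kernel_def sets_borel)

lemma prob_space_kernel:
  assumes r: "0 < r"
  shows "prob_space (kernel r x)"
proof
  have "emeasure (kernel r x) (space (kernel r x)) = (\<integral>\<^sup>+ y. 1 \<partial>kernel r x)" by simp
  also have "\<dots> = (\<integral>\<^sup>+ y. ennreal (conductance r x y / total_conductance r x) \<partial>\<mu>)"
    by (subst nn_integral_kernel[OF r]) auto
  also have "\<dots> = ennreal (\<integral>y. conductance r x y / total_conductance r x \<partial>\<mu>)"
    using total_conductance_ge_1[OF r, of x] conductance_nonneg[of r x]
    by (intro nn_integral_eq_integral) (auto intro!: integrable_conductance r divide_nonneg_nonneg)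
  also have "(\<integral>y. conductance r x y / total_conductance r x \<partial>\<mu>) = 1"
    using total_conductance_ge_1[OF r, of x] by (simp add: total_conductance_def)
  finally show "emeasure (kernel r x) (space (kernel r x)) = 1" by simp
qed

lemma markov_kernel_kernel:
  assumes r: "0 < r"
  shows "markov_kernel borel (kernel r)"
proof
  have "kernel r \<in> borel \<rightarrow>\<^sub>M subprob_algebra borel"
  proof (rule measurable_subprob_algebra)
    show "subprob_space (kernel r x)" for x
      using prob_space_kernel[OF r] by (rule prob_space_imp_subprob_space)
    fix A :: "'a set" assume "A \<in> sets borel"
    then have A [measurable]: "A \<in> sets \<mu>" by (simp add: sets_borel)
    have "(\<lambda>x. emeasure (kernel r x) A) =
        (\<lambda>x. \<integral>\<^sup>+ y. ennreal (conductance r x y / total_conductance r x) * indicator A y \<partial>\<mu>)"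
    proof
      fix x
      have "emeasure (kernel r x) A = (\<integral>\<^sup>+ y. indicator A y \<partial>kernel r x)"
        using A by (simp add: sets_kernel sets_borel)
      then show "emeasure (kernel r x) A =
          (\<integral>\<^sup>+ y. ennreal (conductance r x y / total_conductance r x) * indicator A y \<partial>\<mu>)"
        by (simp add: nn_integral_kernel[OF r])
    qed
    also have "\<dots> \<in> borel_measurable \<mu>"
      by (rule borel_measurable_nn_integral) (simp add: case_prod_beta')
    finally show "(\<lambda>x. emeasure (kernel r x) A) \<in> borel_measurable borel"
      by (simp add: measurable_cong_sets[OF sets_borel refl])
  qed (rule sets_kernel)
  then show "kernel r \<in> borel \<rightarrow>\<^sub>M prob_algebra borel"
    by (intro measurable_prob_algebraI prob_space_kernel r)
qed

lemma mean_exit_step_eq: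
  "mean_exit_step \<mu> r B x = (\<integral>\<^sup>+ Y. exit_step B Y \<partial>markov_chain borel (kernel r) x)"
  by (simp add: mean_exit_step_def walk_def kernel_def[abs_def])

section \<open>Lower bound for exit times\<close>

lemma integrable_tent_square:
  assumes R: "0 < R"
  shows "integrable \<mu> (\<lambda>x. (max 0 (R - dist x0 x))\<^sup>2)"
proof (rule integrable_const_bound[where B="R\<^sup>2"])
  show "AE x in \<mu>. norm ((max 0 (R - dist x0 x))\<^sup>2) \<le> R\<^sup>2"
    using R by (auto intro!: AE_I2 power_mono)
  have "(\<lambda>x. (max 0 (R - dist x0 x))\<^sup>2) \<in> borel_measurable borel"
    by (intro borel_measurable_continuous_onI continuous_intros)
  then show "(\<lambda>x. (max 0 (R - dist x0 x))\<^sup>2) \<in> borel_measurable \<mu>"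
    by (simp add: measurable_cong_sets[OF sets_borel refl])
qed

text \<open>The tent is at least \<open>R / 2\<close> on the ball of radius \<open>R / 2\<close>,
  which has positive mass by full support.\<close>

lemma integral_tent_square_pos:
  assumes R: "0 < R"
  shows "0 < (\<integral>x. (max 0 (R - dist x0 x))\<^sup>2 \<partial>\<mu>)"
proof -
  have "0 < (R / 2)\<^sup>2 * measure \<mu> (ball x0 (R / 2))"
    using R supp by (simp add: full_support_def)
  also have "\<dots> = (\<integral>x. (R / 2)\<^sup>2 * indicator (ball x0 (R / 2)) x \<partial>\<mu>)"
    by simp
  also have "\<dots> \<le> (\<integral>x. (max 0 (R - dist x0 x))\<^sup>2 \<partial>\<mu>)"
  proof (rule integral_mono[OF _ integrable_tent_square[OF R]])
    show "integrable \<mu> (\<lambda>x. (R / 2)\<^sup>2 * indicator (ball x0 (R / 2)) x)"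
      by (intro integrable_mult_right integrable_real_indicator) (auto simp: less_top[symmetric])
    show "(R / 2)\<^sup>2 * indicator (ball x0 (R / 2)) x \<le> (max 0 (R - dist x0 x))\<^sup>2" for x
      using R by (auto split: split_indicator intro!: power_mono)
  qed
  finally show ?thesis .
qed

text \<open>This is \<open>ground_state_inequality\<close> for the sojourn function and the tent. On
  the ball \<open>total_conductance\<close> is at least 1 and the sojourn at most \<open>m\<close>,
  so the left side dominates the tent integral times \<open>2 / m\<close>; the right side is
  \<open>2 * r\<^sup>2\<close> times the total mass.\<close>

lemma integral_tent_square_le:
  assumes r: "0 < r" and R: "0 < R" and m: "1 \<le> m"
    and mean: "\<And>y. y \<in> cball x0 R \<Longrightarrow> mean_exit_step \<mu> r (cball x0 R) y \<le> ennreal m"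
  shows "(\<integral>x. (max 0 (R - dist x0 x))\<^sup>2 \<partial>\<mu>) \<le> m * r\<^sup>2 * measure \<mu> UNIV"
proof -
  interpret K: markov_kernel borel "kernel r" by (rule markov_kernel_kernel[OF r])
  define B where "B = cball x0 R"
  have B: "B \<in> sets borel" by (simp add: B_def)
  then have B' [measurable]: "B \<in> sets \<mu>" by (simp add: sets_borel)
  define f where "f x = max 0 (R - dist x0 x)" for x
  have f_meas [measurable]: "f \<in> borel_measurable \<mu>"
    unfolding measurable_cong_sets[OF sets_borel refl] f_def[abs_def]
    by (intro borel_measurable_continuous_onI continuous_intros)
  have u_meas [measurable]: "K.sojourn B \<in> borel_measurable \<mu>"
    using K.measurable_sojourn[OF B] by (simp add: measurable_cong_sets[OF sets_borel refl])
  have u_eq: "K.sojourn B x = 1 + (\<integral>\<^sup>+ z. indicator B z * K.sojourn B z \<partial>kernel r x)" for x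
    by (rule K.sojourn_eq[OF B]) simp
  have u_in: "K.sojourn B x \<le> ennreal m" if "x \<in> B" for x
    using K.sojourn_le_mean_exit_step[OF B _ that] mean[of x] that
    by (simp add: mean_exit_step_eq B_def)
  \<comment> \<open>The energy argument needs a bound at every point. From outside \<open>B\<close>,
    one step leads to a sojourn of at most \<open>m\<close>, hence \<open>1 + m\<close>.\<close>
  have u_le: "K.sojourn B x \<le> ennreal (1 + m)" for x
  proof -
    interpret prob_space "kernel r x" by (rule prob_space_kernel[OF r])
    have "(\<integral>\<^sup>+ z. indicator B z * K.sojourn B z \<partial>kernel r x) \<le> (\<integral>\<^sup>+ z. ennreal m \<partial>kernel r x)"
      using u_in by (intro nn_integral_mono) (auto split: split_indicator)
    also have "\<dots> = ennreal m" by (simp add: emeasure_space_1)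
    finally show ?thesis
      using m by (subst u_eq) (simp add: ennreal_plus add_left_mono)
  qed
  define U where "U x = enn2real (K.sojourn B x)" for x
  have U_meas [measurable]: "U \<in> borel_measurable \<mu>" unfolding U_def[abs_def] by measurable
  have U: "ennreal (U x) = K.sojourn B x" for x
    unfolding U_def by (intro ennreal_enn2real le_less_trans[OF u_le[of x]]) simp
  have U_ge: "1 \<le> U x" for x
  proof -
    have "ennreal 1 \<le> ennreal (U x)" unfolding U by (subst u_eq) simp
    then show ?thesis by (simp add: U_def)
  qed
  have U_le: "U x \<le> 1 + m" for x
    using u_le[of x] m unfolding U[symmetric] by (subst (asm) ennreal_le_iff) auto
  have U_in: "U x \<le> m" if "x \<in> B" for x
    using u_in[OF that] m unfolding U[symmetric] by simp
  obtain b where b: "\<And>x y. conductance r x y \<le> b" using conductance_bounded[OF r] by blast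
  obtain c where c: "\<And>x. total_conductance r x \<le> c" using total_conductance_bounded[OF r] by blast
  have a: "1 \<le> total_conductance r x" for x by (rule total_conductance_ge_1[OF r])
  \<comment> \<open>This is \<open>u_eq\<close> multiplied by \<open>total_conductance r x\<close>
    and moved from \<open>ennreal\<close> to real integrals; the finite bound on \<open>U\<close>
    makes the passage legitimate.\<close>
  have eq: "(\<integral>y. conductance r x y * (indicator B y * U y) \<partial>\<mu>) = (\<integral>y. conductance r x y \<partial>\<mu>) * (U x - 1)" for x
  proof -
    let ?I = "\<integral>y. conductance r x y / total_conductance r x * (indicator B y * U y) \<partial>\<mu>"
    have pos: "0 \<le> conductance r x y / total_conductance r x" for y
      using conductance_nonneg[of r x y] a[of x] by simp
    have int: "integrable \<mu> (\<lambda>y. conductance r x y / total_conductance r x * (indicator B y * U y))"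
    proof (rule Bochner_Integration.integrable_bound)
      show "integrable \<mu> (\<lambda>y. (1 + m) * (conductance r x y / total_conductance r x))"
        using integrable_conductance[OF r] by simp
      show "AE y in \<mu>. norm (conductance r x y / total_conductance r x * (indicator B y * U y))
          \<le> norm ((1 + m) * (conductance r x y / total_conductance r x))"
      proof (rule AE_I2)
        fix y
        have "\<bar>indicator B y * U y\<bar> \<le> 1 + m"
          using U_ge[of y] U_le[of y] m by (auto split: split_indicator)
        from mult_left_mono[OF this pos[of y]]
        show "norm (conductance r x y / total_conductance r x * (indicator B y * U y))
          \<le> norm ((1 + m) * (conductance r x y / total_conductance r x))"
          using conductance_nonneg[of r x y] a[of x] m by (simp add: abs_mult mult.commute)
      qed
    qed measurable
    have I: "0 \<le> ?I"
      using pos U_ge by (intro integral_nonneg_AE AE_I2 mult_nonneg_nonneg) (auto intro: order_trans[of 0 1])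
    have "ennreal (U x) = 1 + (\<integral>\<^sup>+ y. indicator B y * ennreal (U y) \<partial>kernel r x)"
      unfolding U by (rule u_eq)
    also have "(\<integral>\<^sup>+ y. indicator B y * ennreal (U y) \<partial>kernel r x)
      = (\<integral>\<^sup>+ y. ennreal (conductance r x y / total_conductance r x * (indicator B y * U y)) \<partial>\<mu>)"
      using pos U_ge
      by (subst nn_integral_kernel[OF r])
        (auto intro!: nn_integral_cong simp: ennreal_mult'[symmetric] split: split_indicator)
    also have "\<dots> = ennreal ?I"
      using pos U_ge by (intro nn_integral_eq_integral int AE_I2 mult_nonneg_nonneg) (auto intro: order_trans[of 0 1])
    also have "1 + ennreal ?I = ennreal (1 + ?I)" using I by simp
    finally have "U x = 1 + ?I" using I U_ge[of x] by (subst (asm) ennreal_inj) auto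
    moreover have "?I = (\<integral>y. conductance r x y * (indicator B y * U y) \<partial>\<mu>) / total_conductance r x"
      by simp
    ultimately show ?thesis
      using a[of x] by (simp add: total_conductance_def field_simps)
  qed
  have gs: "2 * (\<integral>x. (f x)\<^sup>2 * total_conductance r x / U x \<partial>\<mu>) \<le> r\<^sup>2 * (\<integral>x. total_conductance r x \<partial>\<mu>)"
    unfolding total_conductance_def
  proof (rule ground_state_inequality[where J="conductance r" and b=b and L="1 + m" and F=R and B=B])
    show "\<bar>f x\<bar> \<le> R" for x using R by (auto simp: f_def)
    show "f x = 0" if "x \<notin> B" for x using that by (auto simp: f_def B_def)
    show "\<bar>f x - f y\<bar> \<le> r" if "conductance r x y \<noteq> 0" for x y
    proof -
      have "dist x y < r" using that by (auto simp: conductance_def split: split_indicator_asm)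
      then show ?thesis
        using dist_triangle[of x0 x y] dist_triangle[of x0 y x] by (auto simp: f_def dist_commute max_def)
    qed
  qed (rule measurable_conductance conductance_nonneg b conductance_sym U_meas U_ge U_le B' f_meas eq)+
  have fi: "integrable \<mu> (\<lambda>x. (f x)\<^sup>2)"
    unfolding f_def by (rule integrable_tent_square[OF R])
  have "(\<integral>x. (f x)\<^sup>2 \<partial>\<mu>) / m = (\<integral>x. (f x)\<^sup>2 / m \<partial>\<mu>)" by simp
  also have "\<dots> \<le> (\<integral>x. (f x)\<^sup>2 * total_conductance r x / U x \<partial>\<mu>)"
  proof (rule integral_mono)
    show "integrable \<mu> (\<lambda>x. (f x)\<^sup>2 / m)" using fi by simp
    show "integrable \<mu> (\<lambda>x. (f x)\<^sup>2 * total_conductance r x / U x)"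
    proof (rule Bochner_Integration.integrable_bound)
      show "integrable \<mu> (\<lambda>x. c * (f x)\<^sup>2)" using fi by simp
      show "AE x in \<mu>. norm ((f x)\<^sup>2 * total_conductance r x / U x) \<le> norm (c * (f x)\<^sup>2)"
      proof (rule AE_I2)
        fix x
        have "total_conductance r x / U x \<le> c / 1"
          using a[of x] c[of x] U_ge[of x] by (intro frac_le) auto
        then have "(f x)\<^sup>2 * (total_conductance r x / U x) \<le> (f x)\<^sup>2 * c"
          by (intro mult_left_mono) auto
        then show "norm ((f x)\<^sup>2 * total_conductance r x / U x) \<le> norm (c * (f x)\<^sup>2)"
          using a[of x] c[of x] U_ge[of x] by (simp add: abs_mult mult.commute)
      qed
    qed measurable
    \<comment> \<open>The sharper bound \<open>U x \<le> m\<close> holds on \<open>B\<close>;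
      elsewhere the tent vanishes and both sides are 0.\<close>
    show "(f x)\<^sup>2 / m \<le> (f x)\<^sup>2 * total_conductance r x / U x" for x
    proof (cases "x \<in> B")
      case True
      have "1 / m \<le> total_conductance r x / U x"
        using a[of x] U_ge[of x] U_in[OF True] m by (intro frac_le) auto
      then have "(f x)\<^sup>2 * (1 / m) \<le> (f x)\<^sup>2 * (total_conductance r x / U x)"
        by (intro mult_left_mono) auto
      then show ?thesis by simp
    qed (simp add: f_def B_def)
  qed
  also have "\<dots> \<le> r\<^sup>2 * measure \<mu> UNIV"
    using gs unfolding integral_total_conductance[OF r] by simp
  finally show ?thesis
    unfolding f_def using m by (simp add: field_simps)
qed

text \<open>The constant is the tent integral divided by the total mass, so it is independent of
  \<open>r\<close>. An infinite maximum satisfies the bound trivially; a finite one serves as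
  \<open>m\<close> in \<open>integral_tent_square_le\<close>.\<close>

lemma max_mean_exit_step_lower_bound:
  assumes R: "0 < R"
  shows "\<exists>c>0. \<forall>r>0. ennreal (c / r\<^sup>2) \<le> max_mean_exit_step \<mu> r (cball x0 R)"
proof -
  define I where "I = (\<integral>x. (max 0 (R - dist x0 x))\<^sup>2 \<partial>\<mu>)"
  have I: "0 < I" unfolding I_def by (rule integral_tent_square_pos[OF R])
  have \<mu>: "0 < measure \<mu> UNIV"
    using vol_pos[OF R, of x0] finite_measure_mono[of "ball x0 R" UNIV]
    by (auto simp: vol_def sets_borel)
  have "ennreal (I / measure \<mu> UNIV / r\<^sup>2) \<le> max_mean_exit_step \<mu> r (cball x0 R)" if r: "0 < r" for r
  proof (cases "max_mean_exit_step \<mu> r (cball x0 R)")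
    case (real m)
    interpret K: markov_kernel borel "kernel r" by (rule markov_kernel_kernel[OF r])
    have le: "mean_exit_step \<mu> r (cball x0 R) y \<le> ennreal m" if "y \<in> cball x0 R" for y
      unfolding real(2)[symmetric] max_mean_exit_step_def by (rule SUP_upper[OF that])
    \<comment> \<open>The premise \<open>1 \<le> m\<close> of the tent estimate holds because the
      start at the centre already counts as one step.\<close>
    have "1 \<le> K.sojourn (cball x0 R) x0"
      by (subst K.sojourn_eq) auto
    also have "\<dots> \<le> mean_exit_step \<mu> r (cball x0 R) x0"
      unfolding mean_exit_step_eq using R by (intro K.sojourn_le_mean_exit_step) auto
    also have "\<dots> \<le> ennreal m" using R by (intro le) simp
    finally have "1 \<le> m" by simp
    from integral_tent_square_le[OF r R this le] have "I / measure \<mu> UNIV / r\<^sup>2 \<le> m"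
      using r \<mu> by (simp add: I_def field_simps)
    then show ?thesis unfolding real(2) using real(1) by (simp add: ennreal_leI)
  qed simp
  then show ?thesis using I \<mu> by (intro exI[of _ "I / measure \<mu> UNIV"]) auto
qed

text \<open>The scaled lower bound is \<open>c * r powr (\<gamma> - 2)\<close>, which tends to
  infinity as \<open>r\<close> decreases to 0.\<close>

lemma scaled_exit_limsup_infinite:
  assumes R: "0 < R" and \<gamma>: "\<gamma> < 2"
  shows "scaled_exit_limsup \<mu> \<gamma> (cball x0 R) = \<infinity>"
proof -
  obtain c where c: "0 < c" "\<And>r. 0 < r \<Longrightarrow> ennreal (c / r\<^sup>2) \<le> max_mean_exit_step \<mu> r (cball x0 R)"
    using max_mean_exit_step_lower_bound[OF R] by blast
  have "filterlim (\<lambda>r. c / r\<^sup>2 * r powr \<gamma>) at_top (at_right 0)"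
    using c(1) \<gamma> by real_asymp
  then have "((\<lambda>r. ennreal (c / r\<^sup>2 * r powr \<gamma>)) \<longlongrightarrow> \<infinity>) (at_right 0)"
    by (simp add: ennreal_tendsto_top_eq_at_top)
  then have "\<infinity> = Limsup (at_right 0) (\<lambda>r. ennreal (c / r\<^sup>2 * r powr \<gamma>))"
    by (intro lim_imp_Limsup[symmetric]) auto
  also have "\<dots> \<le> scaled_exit_limsup \<mu> \<gamma> (cball x0 R)"
    unfolding scaled_exit_limsup_def
  proof (rule Limsup_mono)
    show "\<forall>\<^sub>F r in at_right 0. ennreal (c / r\<^sup>2 * r powr \<gamma>)
        \<le> max_mean_exit_step \<mu> r (cball x0 R) * ennreal (r powr \<gamma>)"
      using eventually_at_right_less[of "0::real"]
    proof eventually_elim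
      case (elim r)
      then show ?case
        using c by (subst ennreal_mult) (auto intro!: mult_right_mono)
    qed
  qed
  finally show ?thesis by (simp add: top_unique)
qed

text \<open>Every exponent strictly between 0 and 2 belongs to the set whose supremum is taken, so
  each value below 2 is dominated by a member.\<close>

lemma set_time_exponent_cball_ge_2:
  assumes R: "0 < R"
  shows "2 \<le> set_time_exponent \<mu> (cball x0 R)"
proof (rule dense_le)
  fix z :: ennreal
  assume z: "z < 2"
  then obtain t where t: "0 \<le> t" "z = ennreal t" by (cases z) auto
  with z have "t < 2" by (metis ennreal_less_iff ennreal_numeral zero_le_numeral)
  \<comment> \<open>The midpoint of \<open>t\<close> and 2 is positive even for
    \<open>t = 0\<close>, as membership in the set of exponents demands.\<close>
  define \<gamma> where "\<gamma> = (t + 2) / 2"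
  have \<gamma>: "0 < \<gamma>" "\<gamma> < 2" "t \<le> \<gamma>" using t \<open>t < 2\<close> by (auto simp: \<gamma>_def)
  have "z \<le> ennreal \<gamma>" using \<gamma> t by (simp add: ennreal_leI)
  also have "\<dots> \<le> set_time_exponent \<mu> (cball x0 R)"
    unfolding set_time_exponent_def using \<gamma> scaled_exit_limsup_infinite[OF R]
    by (intro Sup_upper) auto
  finally show "z \<le> set_time_exponent \<mu> (cball x0 R)" .
qed

lemma local_time_exponent_ge_2: "2 \<le> local_time_exponent \<mu> x"
  unfolding local_time_exponent_def
  by (intro INF_greatest set_time_exponent_cball_ge_2) simp

end

theorem theorem4p4p7:
  fixes \<mu> :: "'a::metric_space measure"
  assumes "compact (UNIV :: 'a set)" and "connected (UNIV :: 'a set)"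
    and "\<exists>x y :: 'a. x \<noteq> y"
    and "sets \<mu> = sets borel" and "finite_measure \<mu>" and "full_support \<mu>"
    and "doubling \<mu>"
    and "\<exists>b::real. \<forall>x. local_time_exponent \<mu> x \<le> ennreal b"
    and "variable_time_regular \<mu> (\<lambda>x. enn2real (local_time_exponent \<mu> x))"
  shows "\<forall>x. 2 \<le> local_time_exponent \<mu> x"
proof -
  interpret compact_metric_measure \<mu>
    using assms by (intro compact_metric_measure.intro compact_metric_measure_axioms.intro)
  show ?thesis using local_time_exponent_ge_2 by blast
qed

end
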